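(* Let $0<T<\infty$, let $w(t)=t^\alpha$ with $\alpha\ge 0$, let $\mu\ge 0$ be a Borel measure supported on $\mathbb{R}_+$, and let $h(t)=\int_{\mathbb{R}_+}e^{-st}\,d\mu(s)$ for $t>0$ be its Laplace transform. Then the weighted truncated Hankel operator $\Gamma_{h,w}$ on $L^2(0,T)$ given by $$\Gamma_{h,w}u(t)=\int_0^Tw(t)\,h(t+\tau)\,w(\tau)\,u(\tau)\,d\tau$$ is bounded if and only if there is a $\gamma>0$ such that $\mu(0,x)\le\gamma x^{1+2\alpha}$ for all $x\ge 1$.
   Context: $\mathbb{R}_+=(0,\infty)$ and $\mu(0,x)$ denotes the $\mu$-measure of the interval $(0,x)$. *)

theory Defs
  imports "HOL-Analysis.Analysis"
begin

text \<open>Square-integrable functions on \<open>(0,T)\<close>, at the level of representatives: the functions below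
  are not identified when they agree almost everywhere, and only their values on \<open>(0,T)\<close> matter.\<close>

definition L2_on :: "real \<Rightarrow> (real \<Rightarrow> complex) set" where
  "L2_on T = {u. u \<in> borel_measurable (lebesgue_on {0<..<T}) \<and>
                 integrable (lebesgue_on {0<..<T}) (\<lambda>t. (norm (u t))\<^sup>2)}"

definition L2_on_norm :: "real \<Rightarrow> (real \<Rightarrow> complex) \<Rightarrow> real" where
  "L2_on_norm T u = sqrt (LINT t|lebesgue_on {0<..<T}. (norm (u t))\<^sup>2)"

text \<open>The Laplace transform of a nonnegative measure takes values in \<open>[0,\<infinity>]\<close>, so that divergence
  of the defining integral stays visible (a Bochner integral would silently be \<open>0\<close>).\<close>

definition laplace_transform :: "real measure \<Rightarrow> real \<Rightarrow> ennreal" where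
  "laplace_transform M t = (\<integral>\<^sup>+ s\<in>{0<..}. ennreal (exp (- s * t)) \<partial>M)"

definition weighted_hankel ::
    "(real \<Rightarrow> ennreal) \<Rightarrow> (real \<Rightarrow> real) \<Rightarrow> real \<Rightarrow> (real \<Rightarrow> complex) \<Rightarrow> real \<Rightarrow> complex" where
  "weighted_hankel h w T u t =
     (LINT \<tau>|lebesgue_on {0<..<T}. of_real (w t * enn2real (h (t + \<tau>)) * w \<tau>) * u \<tau>)"

text \<open>Absolute convergence of the integral defining \<^const>\<open>weighted_hankel\<close>, for almost every \<open>t\<close>.
  It is tested with the \<open>[0,\<infinity>]\<close>-valued kernel: it fails if the kernel is infinite on a set of
  positive measure where \<open>u\<close> does not vanish, so \<open>enn2real \<infinity> = 0\<close> does no harm when it holds.\<close>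

definition weighted_hankel_defined ::
    "(real \<Rightarrow> ennreal) \<Rightarrow> (real \<Rightarrow> real) \<Rightarrow> real \<Rightarrow> (real \<Rightarrow> complex) \<Rightarrow> bool" where
  "weighted_hankel_defined h w T u \<longleftrightarrow>
     (AE t in lebesgue_on {0<..<T}.
        (\<integral>\<^sup>+ \<tau>. ennreal \<bar>w t\<bar> * h (t + \<tau>) * ennreal \<bar>w \<tau>\<bar> * ennreal (norm (u \<tau>))
           \<partial>lebesgue_on {0<..<T}) < \<infinity>)"

definition weighted_hankel_bounded ::
    "(real \<Rightarrow> ennreal) \<Rightarrow> (real \<Rightarrow> real) \<Rightarrow> real \<Rightarrow> bool" where
  "weighted_hankel_bounded h w T \<longleftrightarrow>
     (\<exists>C. \<forall>u\<in>L2_on T.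
        weighted_hankel_defined h w T u \<and>
        weighted_hankel h w T u \<in> L2_on T \<and>
        L2_on_norm T (weighted_hankel h w T u) \<le> C * L2_on_norm T u)"

end

theory Submission
  imports Defs "HOL-Real_Asymp.Real_Asymp"
begin

text \<open>
  Write \<open>h\<close> for the Laplace transform of \<open>\<mu>\<close> and \<open>p = 1 + 2\<alpha>\<close>. Both sides of the equivalence say the
  same thing about the size of \<open>h\<close> near \<open>0\<close>, namely \<open>h(t) \<le> B t\<^sup>-\<^sup>p\<close> for \<open>0 < t < 2T\<close> with some
  constant \<open>B\<close>, and the proof passes through this decay condition.

  Decay is equivalent to boundedness (\<open>weighted_hankel_bounded_of_decay\<close> and
  \<open>decay_of_weighted_hankel_bounded\<close>). Since \<open>t\<^sup>\<alpha> \<tau>\<^sup>\<alpha> \<le> (t + \<tau>)\<^sup>2\<^sup>\<alpha>\<close>, decay bounds the kernel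
  \<open>t\<^sup>\<alpha> h(t + \<tau>) \<tau>\<^sup>\<alpha>\<close> by \<open>B / (t + \<tau>)\<close>, and the operator with kernel \<open>1 / (t + \<tau>)\<close> is bounded by
  Hilbert's inequality, which is a Schur test with the weight \<open>\<tau>\<^sup>-\<^sup>1\<^sup>/\<^sup>2\<close>. Conversely,
  because \<open>h\<close> decreases, the kernel is at least \<open>a\<^sup>2\<^sup>\<alpha> h(4a)\<close> on the square \<open>(a, 2a) \<times> (a, 2a)\<close>;
  testing the operator on the indicator function of \<open>(a, 2a)\<close> gives
  \<open>a\<^sup>p h(4a) \<le> \<bar>C\<bar>\<close>, which is decay at \<open>t = 4a\<close>. Here \<open>h\<close> must be known to be finite beforehand:
  this is contained in the absolute convergence of the integral for the constant function \<open>1\<close>.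

  Decay is equivalent to growth of \<open>\<mu>\<close> (\<open>laplace_transform_ge\<close> and
  \<open>laplace_transform_le_of_growth\<close>). The integrand of \<open>h(t)\<close> is at least \<open>e\<^sup>-\<^sup>x\<^sup>t\<close> on \<open>(0, x)\<close>, so
  \<open>\<mu>(0, x) \<le> e\<^sup>x\<^sup>t h(t)\<close>, and the choice of \<open>t\<close> proportional to \<open>1 / x\<close> turns decay into growth. In
  the other direction, cutting \<open>(0, \<infinity>)\<close> into pieces of length \<open>1 / t\<close> bounds \<open>h(t)\<close> by the sum of
  \<open>e\<^sup>-\<^sup>k \<mu>(0, (k + 1) / t)\<close>, which the growth condition makes a multiple of \<open>t\<^sup>-\<^sup>p\<close>.
\<close>

section \<open>Hilbert's inequality on an interval\<close>

text \<open>The substitution \<open>\<tau> = t x\<^sup>2\<close> turns the integrand into a multiple of \<open>1 / (1 + x\<^sup>2)\<close>, which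
  explains the arctangent in the primitive \<open>F\<close> below. The primitive is continuous at \<open>0\<close> although
  the integrand blows up there.\<close>

lemma nn_integral_hilbert_kernel_le:
  fixes t T :: real
  assumes "0 < t" "0 < T"
  shows "(\<integral>\<^sup>+\<tau>. ennreal (1 / (sqrt \<tau> * (t + \<tau>))) \<partial>lebesgue_on {0<..<T}) \<le> ennreal (pi / sqrt t)"
proof -
  define F where "F = (\<lambda>\<tau>. 2 / sqrt t * arctan (sqrt \<tau> / sqrt t))"
  define f where "f = (\<lambda>\<tau>. 1 / (sqrt \<tau> * (t + \<tau>)))"
  have deriv: "(F has_vector_derivative f \<tau>) (at \<tau>)" if "\<tau> \<in> {0<..<T}" for \<tau>
  proof -
    have \<tau>: "0 < \<tau>" using that by simp
    have "(F has_real_derivative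
        2 / sqrt t * (inverse (1 + (sqrt \<tau> / sqrt t)\<^sup>2) * (inverse (sqrt \<tau>) / 2 / sqrt t))) (at \<tau>)"
      unfolding F_def using \<tau> assms
      by (intro DERIV_cmult DERIV_chain2[OF DERIV_arctan] DERIV_cdivide DERIV_real_sqrt)
    moreover have "2 / sqrt t * (inverse (1 + (sqrt \<tau> / sqrt t)\<^sup>2) * (inverse (sqrt \<tau>) / 2 / sqrt t)) = f \<tau>"
    proof -
      have "1 + (sqrt \<tau> / sqrt t)\<^sup>2 = (t + \<tau>) / t"
        using \<tau> assms by (simp add: power_divide add_divide_distrib)
      moreover have "2 / sqrt t * (inverse ((t + \<tau>) / t) * (inverse (sqrt \<tau>) / 2 / sqrt t))
          = t / (sqrt t * sqrt t) * f \<tau>"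
        by (simp add: f_def divide_simps)
      ultimately show ?thesis using assms by simp
    qed
    ultimately show ?thesis by (simp add: has_real_derivative_iff_has_vector_derivative)
  qed
  have "(f has_integral (F T - F 0)) {0..T}"
    using assms deriv
    by (intro fundamental_theorem_of_calculus_interior)
       (auto simp: F_def intro!: continuous_intros)
  then have *: "integral\<^sup>N lborel (\<lambda>\<tau>. indicator {0..T} \<tau> * f \<tau>) = F T - F 0"
    using assms by (intro nn_integral_has_integral_lebesgue) (auto simp: f_def)
  have "(\<integral>\<^sup>+\<tau>. ennreal (f \<tau>) \<partial>lebesgue_on {0<..<T}) =
      (\<integral>\<^sup>+\<tau>. ennreal (f \<tau>) * indicator {0<..<T} \<tau> \<partial>lborel)"
    by (simp add: nn_integral_restrict_space nn_integral_completion)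
  also have "\<dots> \<le> (\<integral>\<^sup>+\<tau>. indicator {0..T} \<tau> * f \<tau> \<partial>lborel)"
    by (intro nn_integral_mono) (auto simp: indicator_def)
  also have "\<dots> = ennreal (F T - F 0)" by (fact *)
  also have "\<dots> \<le> ennreal (pi / sqrt t)"
  proof (rule ennreal_leI)
    have "arctan (sqrt T / sqrt t) \<le> pi / 2" using arctan_ubound less_imp_le by blast
    then have "2 / sqrt t * arctan (sqrt T / sqrt t) \<le> 2 / sqrt t * (pi / 2)"
      using assms by (intro mult_left_mono) auto
    then show "F T - F 0 \<le> pi / sqrt t" by (simp add: F_def)
  qed
  finally show ?thesis by (simp add: f_def)
qed

lemma sigma_finite_lebesgue_on_interval: "sigma_finite_measure (lebesgue_on {a<..<b::real})"
  by (intro finite_measure.axioms finite_measure_lebesgue_on) auto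

text \<open>Schur's test: split \<open>1 / (t + \<tau>)\<close> into two square roots, give one factor the weight
  \<open>\<tau>\<^sup>-\<^sup>1\<^sup>/\<^sup>2\<close> and the other its reciprocal, and apply Cauchy-Schwarz in \<open>\<tau>\<close>. After Tonelli, the integrals
  in \<open>\<tau>\<close> and in \<open>t\<close> are both instances of the previous computation, and each contributes a factor \<open>\<pi>\<close>.\<close>

lemma hilbert_inequality:
  fixes T :: real and v :: "real \<Rightarrow> ennreal"
  assumes "0 < T" and [measurable]: "v \<in> borel_measurable (lebesgue_on {0<..<T})"
  shows "(\<integral>\<^sup>+t. (\<integral>\<^sup>+\<tau>. ennreal (1 / (t + \<tau>)) * v \<tau> \<partial>lebesgue_on {0<..<T})\<^sup>2 \<partial>lebesgue_on {0<..<T})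
     \<le> ennreal (pi\<^sup>2) * (\<integral>\<^sup>+\<tau>. (v \<tau>)\<^sup>2 \<partial>lebesgue_on {0<..<T})"
proof -
  let ?L = "lebesgue_on {0<..<T}"
  interpret sigma_finite_measure ?L by (rule sigma_finite_lebesgue_on_interval)
  interpret P: pair_sigma_finite ?L ?L ..
  have [measurable]: "(\<lambda>x. x) \<in> borel_measurable ?L"
    using id_borel_measurable_lebesgue_on[of "{0<..<T}"] by (simp add: id_def)
  have inner: "(\<integral>\<^sup>+\<tau>. ennreal (1 / (t + \<tau>)) * v \<tau> \<partial>?L)\<^sup>2
      \<le> (\<integral>\<^sup>+\<tau>. ennreal (pi / sqrt t) * (ennreal (sqrt \<tau> / (t + \<tau>)) * (v \<tau>)\<^sup>2) \<partial>?L)"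
    if t: "0 < t" for t
  proof -
    let ?f = "\<lambda>\<tau>. ennreal (sqrt (1 / (sqrt \<tau> * (t + \<tau>))))"
    let ?g = "\<lambda>\<tau>. ennreal (sqrt (sqrt \<tau> / (t + \<tau>))) * v \<tau>"
    have "(\<integral>\<^sup>+\<tau>. ennreal (1 / (t + \<tau>)) * v \<tau> \<partial>?L) = (\<integral>\<^sup>+\<tau>. ?f \<tau> * ?g \<tau> \<partial>?L)"
    proof (rule nn_integral_cong)
      fix \<tau> assume "\<tau> \<in> space ?L"
      then have \<tau>: "0 < \<tau>" by simp
      have "sqrt (1 / (sqrt \<tau> * (t + \<tau>))) * sqrt (sqrt \<tau> / (t + \<tau>)) = sqrt ((1 / (t + \<tau>))\<^sup>2)"
        unfolding real_sqrt_mult[symmetric] using \<tau> t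
        by (intro arg_cong[of _ _ sqrt]) (simp add: power2_eq_square)
      also have "\<dots> = 1 / (t + \<tau>)" using \<tau> t by simp
      finally show "ennreal (1 / (t + \<tau>)) * v \<tau> = ?f \<tau> * ?g \<tau>"
        using \<tau> t by (simp add: mult.assoc[symmetric] ennreal_mult[symmetric])
    qed
    then have "(\<integral>\<^sup>+\<tau>. ennreal (1 / (t + \<tau>)) * v \<tau> \<partial>?L)\<^sup>2
        \<le> (\<integral>\<^sup>+\<tau>. (?f \<tau>)\<^sup>2 \<partial>?L) * (\<integral>\<^sup>+\<tau>. (?g \<tau>)\<^sup>2 \<partial>?L)"
      using Cauchy_Schwarz_nn_integral[of ?f ?L ?g] by simp
    also have "(\<integral>\<^sup>+\<tau>. (?f \<tau>)\<^sup>2 \<partial>?L) = (\<integral>\<^sup>+\<tau>. ennreal (1 / (sqrt \<tau> * (t + \<tau>))) \<partial>?L)"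
      using t by (intro nn_integral_cong) (simp add: ennreal_power)
    also have "(\<integral>\<^sup>+\<tau>. (?g \<tau>)\<^sup>2 \<partial>?L) = (\<integral>\<^sup>+\<tau>. ennreal (sqrt \<tau> / (t + \<tau>)) * (v \<tau>)\<^sup>2 \<partial>?L)"
      using t by (intro nn_integral_cong) (simp add: power_mult_distrib ennreal_power)
    also have "(\<integral>\<^sup>+\<tau>. ennreal (1 / (sqrt \<tau> * (t + \<tau>))) \<partial>?L) * \<dots> \<le> ennreal (pi / sqrt t) * \<dots>"
      using nn_integral_hilbert_kernel_le[OF t assms(1)] by (rule mult_right_mono) simp
    finally show ?thesis by (subst nn_integral_cmult) auto
  qed
  have outer: "(\<integral>\<^sup>+t. ennreal (pi / sqrt t) * (ennreal (sqrt \<tau> / (t + \<tau>)) * (v \<tau>)\<^sup>2) \<partial>?L)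
      \<le> ennreal (pi\<^sup>2) * (v \<tau>)\<^sup>2" if \<tau>: "0 < \<tau>" for \<tau>
  proof -
    have "(\<integral>\<^sup>+t. ennreal (pi / sqrt t) * (ennreal (sqrt \<tau> / (t + \<tau>)) * (v \<tau>)\<^sup>2) \<partial>?L) =
        (\<integral>\<^sup>+t. ennreal (pi * sqrt \<tau>) * (v \<tau>)\<^sup>2 * ennreal (1 / (sqrt t * (\<tau> + t))) \<partial>?L)"
      using \<tau> by (intro nn_integral_cong)
        (simp add: ennreal_mult[symmetric] mult.assoc[symmetric] mult.commute[of _ "(v \<tau>)\<^sup>2"] add.commute,
         simp add: mult.assoc ennreal_mult[symmetric])
    also have "\<dots> = ennreal (pi * sqrt \<tau>) * (v \<tau>)\<^sup>2 * (\<integral>\<^sup>+t. ennreal (1 / (sqrt t * (\<tau> + t))) \<partial>?L)"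
      by (intro nn_integral_cmult) auto
    also have "\<dots> \<le> ennreal (pi * sqrt \<tau>) * (v \<tau>)\<^sup>2 * ennreal (pi / sqrt \<tau>)"
      using nn_integral_hilbert_kernel_le[OF \<tau> assms(1)] by (rule mult_left_mono) simp
    also have "\<dots> = ennreal (pi * sqrt \<tau> * (pi / sqrt \<tau>)) * (v \<tau>)\<^sup>2"
      using \<tau> by (subst ennreal_mult) (auto simp: mult_ac)
    also have "pi * sqrt \<tau> * (pi / sqrt \<tau>) = pi\<^sup>2"
      using \<tau> by (simp add: power2_eq_square)
    finally show ?thesis .
  qed
  have "(\<integral>\<^sup>+t. (\<integral>\<^sup>+\<tau>. ennreal (1 / (t + \<tau>)) * v \<tau> \<partial>?L)\<^sup>2 \<partial>?L)
      \<le> (\<integral>\<^sup>+t. (\<integral>\<^sup>+\<tau>. ennreal (pi / sqrt t) * (ennreal (sqrt \<tau> / (t + \<tau>)) * (v \<tau>)\<^sup>2) \<partial>?L) \<partial>?L)"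
    using inner by (intro nn_integral_mono) simp
  also have "\<dots> = (\<integral>\<^sup>+\<tau>. (\<integral>\<^sup>+t. ennreal (pi / sqrt t) * (ennreal (sqrt \<tau> / (t + \<tau>)) * (v \<tau>)\<^sup>2) \<partial>?L) \<partial>?L)"
    by (rule P.Fubini'[symmetric]) measurable
  also have "\<dots> \<le> (\<integral>\<^sup>+\<tau>. ennreal (pi\<^sup>2) * (v \<tau>)\<^sup>2 \<partial>?L)"
    using outer by (intro nn_integral_mono) simp
  also have "\<dots> = ennreal (pi\<^sup>2) * (\<integral>\<^sup>+\<tau>. (v \<tau>)\<^sup>2 \<partial>?L)"
    by (intro nn_integral_cmult) auto
  finally show ?thesis .
qed

section \<open>Decay of the Laplace transform and growth of the measure\<close>

lemma laplace_transform_antimono: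
  assumes "s \<le> t"
  shows "laplace_transform M t \<le> laplace_transform M s"
  unfolding laplace_transform_def
  using assms by (intro nn_integral_mono) (auto simp: indicator_def intro!: ennreal_leI)

text \<open>Measurability comes from monotonicity rather than from Tonelli, since \<open>M\<close> may fail to be
  \<open>\<sigma>\<close>-finite.\<close>

lemma borel_measurable_laplace_transform: "laplace_transform M \<in> borel_measurable borel"
proof (rule borel_measurableI_greater)
  fix y
  have "is_interval {t. y < laplace_transform M t}"
    unfolding is_interval_1 using laplace_transform_antimono
    by (meson mem_Collect_eq order_less_le_trans)
  then show "{t \<in> space borel. y < laplace_transform M t} \<in> sets borel"
    by (simp add: real_interval_borel_measurable)
qed

lemma laplace_transform_ge:
  assumes "sets M = sets borel" "0 \<le> t"
  shows "ennreal (exp (- (x * t))) * emeasure M {0<..<x} \<le> laplace_transform M t"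
proof -
  have "ennreal (exp (- (x * t))) * emeasure M {0<..<x} =
      (\<integral>\<^sup>+s. ennreal (exp (- (x * t))) * indicator {0<..<x} s \<partial>M)"
    using assms by (intro nn_integral_cmult_indicator[symmetric]) auto
  also have "\<dots> \<le> laplace_transform M t"
    unfolding laplace_transform_def using assms
    by (intro nn_integral_mono)
       (auto simp: indicator_def mult_right_mono intro!: ennreal_leI)
  finally show ?thesis .
qed

text \<open>If \<open>n \<le> s t < n + 1\<close>, then \<open>e\<^sup>-\<^sup>s\<^sup>t \<le> e\<^sup>-\<^sup>n\<close> and \<open>s\<close> lies in \<open>(0, (n + 1) / t)\<close>. So the integrand
  is dominated by a sum of multiples of indicator functions of initial intervals, to which the growth
  condition applies because \<open>b \<le> 1 / t\<close>.\<close>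

lemma laplace_transform_le_of_growth:
  fixes b p \<gamma> :: real
  assumes M: "sets M = sets borel" and "0 \<le> \<gamma>"
    and growth: "\<And>x. b \<le> x \<Longrightarrow> emeasure M {0<..<x} \<le> ennreal (\<gamma> * x powr p)"
  obtains B where "0 \<le> B"
    and "\<And>t. 0 < t \<Longrightarrow> t * b \<le> 1 \<Longrightarrow> laplace_transform M t \<le> ennreal (B * t powr (- p))"
proof
  define a where "a = (\<lambda>k::nat. exp (- real k) * real (k + 1) powr p)"
  have a_nonneg: "0 \<le> a k" for k by (simp add: a_def)
  have a: "summable a"
  proof (rule summable_comparison_test_bigo)
    show "summable (\<lambda>k. norm (inverse (real k ^ 2)))"
      using inverse_power_summable[of 2, where 'a=real] by simp
    show "a \<in> O(\<lambda>k. inverse (real k ^ 2))" unfolding a_def by real_asymp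
  qed
  define B where "B = \<gamma> * suminf a"
  show "0 \<le> B" using \<open>0 \<le> \<gamma>\<close> a a_nonneg by (simp add: B_def suminf_nonneg)
  fix t :: real assume t: "0 < t" "t * b \<le> 1"
  have "laplace_transform M t \<le>
      (\<integral>\<^sup>+s. (\<Sum>k. ennreal (exp (- real k)) * indicator {0<..<real (k + 1) / t} s) \<partial>M)"
    unfolding laplace_transform_def
  proof (rule nn_integral_mono)
    fix s :: real
    let ?f = "\<lambda>k. ennreal (exp (- real k)) * indicator {0<..<real (k + 1) / t} s"
    have term_le: "g n \<le> (\<Sum>k. g k)" for g :: "nat \<Rightarrow> ennreal" and n
      using sum_le_suminf[of g "{n}"] by simp
    show "ennreal (exp (- s * t)) * indicator {0<..} s \<le> (\<Sum>k. ?f k)"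
    proof (cases "0 < s")
      case True
      define n where "n = nat \<lfloor>s * t\<rfloor>"
      have n: "real n \<le> s * t" "s * t < real n + 1"
        unfolding n_def using True t by (auto simp: of_nat_nat)
      have "s * t < real (n + 1)" using n by simp
      then have "s < real (n + 1) / t" using t by (simp add: pos_less_divide_eq)
      then have "ennreal (exp (- s * t)) \<le> ?f n"
        using True n by (auto intro!: ennreal_leI)
      also have "\<dots> \<le> (\<Sum>k. ?f k)"
        by (rule term_le)
      finally show ?thesis using True by simp
    qed simp
  qed
  also have "\<dots> = (\<Sum>k. (\<integral>\<^sup>+s. ennreal (exp (- real k)) * indicator {0<..<real (k + 1) / t} s \<partial>M))"
    using M by (intro nn_integral_suminf) simp
  also have "\<dots> = (\<Sum>k. ennreal (exp (- real k)) * emeasure M {0<..<real (k + 1) / t})"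
    using M by (intro suminf_cong nn_integral_cmult_indicator) auto
  also have "\<dots> \<le> (\<Sum>k. ennreal (\<gamma> * t powr (- p) * a k))"
  proof (intro suminf_le summableI)
    fix k
    have "b \<le> 1 / t" using t by (simp add: pos_le_divide_eq mult.commute)
    also have "\<dots> \<le> real (k + 1) / t" using t by (intro divide_right_mono) auto
    finally have "emeasure M {0<..<real (k + 1) / t} \<le> ennreal (\<gamma> * (real (k + 1) / t) powr p)"
      by (rule growth)
    then have "ennreal (exp (- real k)) * emeasure M {0<..<real (k + 1) / t} \<le>
        ennreal (exp (- real k)) * ennreal (\<gamma> * (real (k + 1) / t) powr p)"
      by (rule mult_left_mono) simp
    also have "\<dots> = ennreal (exp (- real k) * (\<gamma> * (real (k + 1) / t) powr p))"
      using \<open>0 \<le> \<gamma>\<close> by (intro ennreal_mult[symmetric]) auto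
    also have "exp (- real k) * (\<gamma> * (real (k + 1) / t) powr p) = \<gamma> * t powr (- p) * a k"
      using t by (simp add: a_def powr_divide powr_minus field_simps)
    finally show "ennreal (exp (- real k)) * emeasure M {0<..<real (k + 1) / t}
        \<le> ennreal (\<gamma> * t powr (- p) * a k)" .
  qed
  also have "\<dots> = ennreal (\<Sum>k. \<gamma> * t powr (- p) * a k)"
    using \<open>0 \<le> \<gamma>\<close> a a_nonneg by (intro suminf_ennreal2 summable_mult) auto
  also have "(\<Sum>k. \<gamma> * t powr (- p) * a k) = B * t powr (- p)"
    using a by (simp add: B_def suminf_mult)
  finally show "laplace_transform M t \<le> ennreal (B * t powr (- p))" .
qed

section \<open>Decay of the kernel and boundedness of the operator\<close>

lemma emeasure_lebesgue_on_interval: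
  fixes a b c d :: real
  assumes "a \<le> c" "c \<le> d" "d \<le> b"
  shows "emeasure (lebesgue_on {a<..<b}) {c<..<d} = ennreal (d - c)"
  using assms by (subst emeasure_restrict_space) auto

lemma sets_lebesgue_on_interval:
  fixes a b c d :: real
  assumes "a \<le> c" "d \<le> b"
  shows "{c<..<d} \<in> sets (lebesgue_on {a<..<b})"
  using assms by (auto simp: sets_restrict_space_iff)

lemma AE_lebesgue_on_interval_witness:
  fixes a b c d :: real
  assumes "AE t in lebesgue_on {a<..<b}. P t" "a \<le> c" "c < d" "d \<le> b"
  obtains t where "c < t" "t < d" "P t"
proof (rule ccontr)
  assume "\<not> thesis"
  with that have "\<not> P t" if "c < t" "t < d" for t using that by blast
  with assms(1) have "AE t in lebesgue_on {a<..<b}. t \<notin> {c<..<d}" by auto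
  then have "emeasure (lebesgue_on {a<..<b}) {c<..<d} = 0"
    using sets_lebesgue_on_interval[of a c d b] assms by (subst (asm) AE_iff_null_sets[symmetric]) auto
  with assms show False by (simp add: emeasure_lebesgue_on_interval)
qed

text \<open>Decay makes the weighted kernel smaller than \<open>B / (t + \<tau>)\<close>, so Hilbert's inequality gives the
  operator norm bound \<open>B * pi\<close>. The estimate is carried out for the \<open>[0,\<infinity>]\<close>-valued integral \<open>G\<close>
  of the absolute values: its square integrability yields absolute convergence almost everywhere, and
  \<open>G\<close> dominates the modulus of the transformed function.\<close>

lemma weighted_hankel_bounded_of_decay:
  fixes T \<alpha> B :: real and h :: "real \<Rightarrow> ennreal"
  assumes "0 < T" "0 \<le> \<alpha>" "0 \<le> B" and h [measurable]: "h \<in> borel_measurable borel"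
    and decay: "\<And>t. 0 < t \<Longrightarrow> t < 2 * T \<Longrightarrow> h t \<le> ennreal (B * t powr (- (1 + 2 * \<alpha>)))"
  shows "weighted_hankel_bounded h (\<lambda>t. t powr \<alpha>) T"
  unfolding weighted_hankel_bounded_def
proof (intro exI[of _ "B * pi"] ballI)
  fix u assume u: "u \<in> L2_on T"
  let ?L = "lebesgue_on {0<..<T}"
  interpret sigma_finite_measure ?L by (rule sigma_finite_lebesgue_on_interval)
  have u_meas [measurable]: "u \<in> borel_measurable ?L" and u_int: "integrable ?L (\<lambda>t. (norm (u t))\<^sup>2)"
    using u by (auto simp: L2_on_def)
  have [measurable]: "(\<lambda>x. x) \<in> borel_measurable ?L"
    using id_borel_measurable_lebesgue_on[of "{0<..<T}"] by (simp add: id_def)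
  define v where "v = (\<lambda>\<tau>. ennreal (norm (u \<tau>)))"
  have [measurable]: "v \<in> borel_measurable ?L" unfolding v_def by measurable
  define N where "N = (LINT t|?L. (norm (u t))\<^sup>2)"
  have N: "0 \<le> N" "(\<integral>\<^sup>+t. (v t)\<^sup>2 \<partial>?L) = ennreal N"
    unfolding N_def v_def using nn_integral_eq_integral[OF u_int] by (auto simp: ennreal_power)
  define G where "G = (\<lambda>t. \<integral>\<^sup>+\<tau>. ennreal \<bar>t powr \<alpha>\<bar> * h (t + \<tau>) * ennreal \<bar>\<tau> powr \<alpha>\<bar> * v \<tau> \<partial>?L)"
  define g where "g = weighted_hankel h (\<lambda>t. t powr \<alpha>) T u"
  have G_meas [measurable]: "G \<in> borel_measurable ?L" unfolding G_def by measurable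
  have g_meas [measurable]: "g \<in> borel_measurable ?L"
    unfolding g_def weighted_hankel_def[abs_def] by measurable
  \<comment> \<open>Both weights are increasing, so each of \<open>t\<close> and \<open>\<tau>\<close> may be replaced by \<open>t + \<tau>\<close>; the exponents
    then add up to \<open>-1\<close>.\<close>
  have kernel: "ennreal \<bar>t powr \<alpha>\<bar> * h (t + \<tau>) * ennreal \<bar>\<tau> powr \<alpha>\<bar> \<le> ennreal B * ennreal (1 / (t + \<tau>))"
    if t: "t \<in> {0<..<T}" and \<tau>: "\<tau> \<in> {0<..<T}" for t \<tau>
  proof -
    have "ennreal \<bar>t powr \<alpha>\<bar> * h (t + \<tau>) * ennreal \<bar>\<tau> powr \<alpha>\<bar>
        \<le> ennreal (t powr \<alpha>) * ennreal (B * (t + \<tau>) powr (- (1 + 2 * \<alpha>))) * ennreal (\<tau> powr \<alpha>)"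
      using t \<tau> decay[of "t + \<tau>"] by (simp add: mult_left_mono mult_right_mono)
    also have "\<dots> = ennreal (t powr \<alpha> * (B * (t + \<tau>) powr (- (1 + 2 * \<alpha>))) * \<tau> powr \<alpha>)"
      using \<open>0 \<le> B\<close> by (simp add: ennreal_mult[symmetric])
    also have "\<dots> \<le> ennreal ((t + \<tau>) powr \<alpha> * (B * (t + \<tau>) powr (- (1 + 2 * \<alpha>))) * (t + \<tau>) powr \<alpha>)"
      using t \<tau> assms by (intro ennreal_leI mult_mono[OF mult_right_mono] powr_mono2) auto
    also have "(t + \<tau>) powr \<alpha> * (B * (t + \<tau>) powr (- (1 + 2 * \<alpha>))) * (t + \<tau>) powr \<alpha>
        = B * (t + \<tau>) powr (\<alpha> + (- (1 + 2 * \<alpha>)) + \<alpha>)"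
      by (simp only: powr_add mult_ac)
    also have "\<alpha> + (- (1 + 2 * \<alpha>)) + \<alpha> = - 1" by simp
    also have "(t + \<tau>) powr - 1 = 1 / (t + \<tau>)" using t \<tau> by (simp add: powr_minus_divide)
    finally show ?thesis using \<open>0 \<le> B\<close> t \<tau> by (simp add: ennreal_mult[symmetric])
  qed
  have "(\<integral>\<^sup>+t. (G t)\<^sup>2 \<partial>?L) \<le> (\<integral>\<^sup>+t. (ennreal B)\<^sup>2 * (\<integral>\<^sup>+\<tau>. ennreal (1 / (t + \<tau>)) * v \<tau> \<partial>?L)\<^sup>2 \<partial>?L)"
  proof (rule nn_integral_mono)
    fix t assume "t \<in> space ?L"
    then have "G t \<le> (\<integral>\<^sup>+\<tau>. ennreal B * (ennreal (1 / (t + \<tau>)) * v \<tau>) \<partial>?L)"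
      unfolding G_def using kernel
      by (intro nn_integral_mono) (simp add: mult.assoc[symmetric] mult_right_mono)
    also have "\<dots> = ennreal B * (\<integral>\<^sup>+\<tau>. ennreal (1 / (t + \<tau>)) * v \<tau> \<partial>?L)"
      by (rule nn_integral_cmult) measurable
    finally show "(G t)\<^sup>2 \<le> (ennreal B)\<^sup>2 * (\<integral>\<^sup>+\<tau>. ennreal (1 / (t + \<tau>)) * v \<tau> \<partial>?L)\<^sup>2"
      unfolding power_mult_distrib[symmetric] by (rule power_mono) simp
  qed
  also have "\<dots> = (ennreal B)\<^sup>2 * (\<integral>\<^sup>+t. (\<integral>\<^sup>+\<tau>. ennreal (1 / (t + \<tau>)) * v \<tau> \<partial>?L)\<^sup>2 \<partial>?L)"
    by (rule nn_integral_cmult) measurable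
  also have "\<dots> \<le> (ennreal B)\<^sup>2 * (ennreal (pi\<^sup>2) * ennreal N)"
    using hilbert_inequality[OF \<open>0 < T\<close>, of v] N by (intro mult_left_mono) auto
  also have "\<dots> = ennreal ((B * pi)\<^sup>2 * N)"
    using \<open>0 \<le> B\<close> N by (simp add: ennreal_mult[symmetric] ennreal_power power_mult_distrib mult.assoc)
  finally have G_le: "(\<integral>\<^sup>+t. (G t)\<^sup>2 \<partial>?L) \<le> ennreal ((B * pi)\<^sup>2 * N)" .
  have "(\<integral>\<^sup>+t. (G t)\<^sup>2 \<partial>?L) \<noteq> \<infinity>"
    using G_le by (auto simp: top_unique)
  then have "AE t in ?L. (G t)\<^sup>2 \<noteq> \<infinity>"
    by (intro nn_integral_noteq_infinite) auto
  then have G_fin: "AE t in ?L. G t < \<infinity>"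
    by eventually_elim (auto simp: less_top power_less_top_ennreal)
  have g_le: "ennreal (norm (g t)) \<le> G t" for t
  proof -
    let ?k = "\<lambda>\<tau>. of_real (t powr \<alpha> * enn2real (h (t + \<tau>)) * \<tau> powr \<alpha>) * u \<tau>"
    have "ennreal (norm (g t)) \<le> (\<integral>\<^sup>+\<tau>. ennreal (norm (?k \<tau>)) \<partial>?L)"
    proof (cases "integrable ?L ?k")
      case True
      then show ?thesis unfolding g_def weighted_hankel_def by (rule integral_norm_bound_ennreal)
    next
      case False
      then show ?thesis unfolding g_def weighted_hankel_def by (simp add: not_integrable_integral_eq)
    qed
    also have "\<dots> \<le> G t"
      unfolding G_def
    proof (rule nn_integral_mono)
      fix \<tau>
      have "ennreal (norm (?k \<tau>)) =
          ennreal \<bar>t powr \<alpha>\<bar> * ennreal (enn2real (h (t + \<tau>))) * ennreal \<bar>\<tau> powr \<alpha>\<bar> * v \<tau>"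
        by (simp add: norm_mult abs_mult v_def ennreal_mult)
      also have "\<dots> \<le> ennreal \<bar>t powr \<alpha>\<bar> * h (t + \<tau>) * ennreal \<bar>\<tau> powr \<alpha>\<bar> * v \<tau>"
        by (intro mult_right_mono mult_left_mono) (auto simp: ennreal_enn2real_if)
      finally show "ennreal (norm (?k \<tau>)) \<le> \<dots>" .
    qed
    finally show ?thesis .
  qed
  have g_nn: "(\<integral>\<^sup>+t. ennreal ((norm (g t))\<^sup>2) \<partial>?L) \<le> ennreal ((B * pi)\<^sup>2 * N)"
  proof -
    have "(\<integral>\<^sup>+t. ennreal ((norm (g t))\<^sup>2) \<partial>?L) \<le> (\<integral>\<^sup>+t. (G t)\<^sup>2 \<partial>?L)"
      using g_le by (intro nn_integral_mono) (simp add: ennreal_power[symmetric] power_mono)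
    with G_le show ?thesis by simp
  qed
  have g_int: "integrable ?L (\<lambda>t. (norm (g t))\<^sup>2)"
  proof (rule integrableI_bounded)
    show "(\<integral>\<^sup>+t. ennreal (norm ((norm (g t))\<^sup>2)) \<partial>?L) < \<infinity>"
      using le_less_trans[OF g_nn] by simp
  qed measurable
  have "ennreal (LINT t|?L. (norm (g t))\<^sup>2) \<le> ennreal ((B * pi)\<^sup>2 * N)"
    using g_nn nn_integral_eq_integral[OF g_int] by simp
  then have "(LINT t|?L. (norm (g t))\<^sup>2) \<le> (B * pi)\<^sup>2 * N"
    using N by (subst (asm) ennreal_le_iff) auto
  then have "L2_on_norm T g \<le> sqrt ((B * pi)\<^sup>2 * N)"
    unfolding L2_on_norm_def by (rule real_sqrt_le_mono)
  also have "\<dots> = B * pi * L2_on_norm T u"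
    using \<open>0 \<le> B\<close> by (simp add: real_sqrt_mult L2_on_norm_def N_def)
  finally have g_norm: "L2_on_norm T g \<le> B * pi * L2_on_norm T u" .
  show "weighted_hankel_defined h (\<lambda>t. t powr \<alpha>) T u \<and>
      weighted_hankel h (\<lambda>t. t powr \<alpha>) T u \<in> L2_on T \<and>
      L2_on_norm T (weighted_hankel h (\<lambda>t. t powr \<alpha>) T u) \<le> B * pi * L2_on_norm T u"
    using G_fin g_int g_norm g_meas
    unfolding weighted_hankel_defined_def G_def v_def g_def[symmetric] L2_on_def by simp
qed

text \<open>For almost all \<open>t\<close> and \<open>\<tau>\<close> in \<open>(0,T)\<close> the kernel is finite, which gives some \<open>t + \<tau> \<le> s\<close> at which \<open>h\<close> is finite,
  and \<open>h\<close> decreases.\<close>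

lemma finite_of_weighted_hankel_defined:
  fixes T \<alpha> s :: real and h :: "real \<Rightarrow> ennreal"
  assumes "0 < T" and [measurable]: "h \<in> borel_measurable borel" and "antimono h"
    and defined: "weighted_hankel_defined h (\<lambda>t. t powr \<alpha>) T (\<lambda>_. 1)"
    and "0 < s"
  shows "h s < \<infinity>"
proof -
  let ?L = "lebesgue_on {0<..<T}"
  define d where "d = min T (s / 2)"
  have d: "0 < d" "d \<le> T" "d \<le> s / 2" using assms by (auto simp: d_def)
  obtain t where t: "0 < t" "t < d"
    and fin: "(\<integral>\<^sup>+\<tau>. ennreal \<bar>t powr \<alpha>\<bar> * h (t + \<tau>) * ennreal \<bar>\<tau> powr \<alpha>\<bar> * ennreal (norm (1::complex)) \<partial>?L) < \<infinity>"
    using AE_lebesgue_on_interval_witness[OF defined[unfolded weighted_hankel_defined_def], of 0 d] d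
    by auto
  obtain \<tau> where \<tau>: "0 < \<tau>" "\<tau> < d"
    and "h (t + \<tau>) < \<infinity>"
  proof -
    have [measurable]: "(\<lambda>x. x) \<in> borel_measurable ?L"
      using id_borel_measurable_lebesgue_on[of "{0<..<T}"] by (simp add: id_def)
    have "AE \<tau> in ?L. ennreal \<bar>t powr \<alpha>\<bar> * h (t + \<tau>) * ennreal \<bar>\<tau> powr \<alpha>\<bar> * ennreal (norm (1::complex)) \<noteq> \<infinity>"
      using fin by (intro nn_integral_noteq_infinite) auto
    from AE_lebesgue_on_interval_witness[OF this, of 0 d] d
    obtain \<tau> where \<tau>: "0 < \<tau>" "\<tau> < d"
      and "ennreal \<bar>t powr \<alpha>\<bar> * h (t + \<tau>) * ennreal \<bar>\<tau> powr \<alpha>\<bar> * ennreal (norm (1::complex)) \<noteq> \<infinity>"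
      by auto
    then have "h (t + \<tau>) < \<infinity>"
      using t by (auto simp: ennreal_mult_eq_top_iff less_top)
    with \<tau> show thesis by (rule that)
  qed
  have "h s \<le> h (t + \<tau>)" using t \<tau> d \<open>antimono h\<close> by (auto intro: antimonoD)
  then show ?thesis using \<open>h (t + \<tau>) < \<infinity>\<close> by (rule le_less_trans)
qed

text \<open>The test function is the indicator function of \<open>(a, 2a)\<close> with \<open>a = t / 4\<close>: all sums of two points
  of this interval lie below \<open>t\<close>, where \<open>h\<close> is at least \<open>h t\<close>, and both weights are at least
  \<open>a powr \<alpha>\<close>. So the image is at least \<open>q = a powr (1 + 2 * \<alpha>) * h t\<close> on \<open>(a, 2a)\<close>, and comparing
  norms gives \<open>q \<le> \<bar>C\<bar>\<close>.\<close>

lemma decay_of_weighted_hankel_bounded: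
  fixes T \<alpha> :: real and h :: "real \<Rightarrow> ennreal"
  assumes "0 < T" "0 \<le> \<alpha>" and h [measurable]: "h \<in> borel_measurable borel" and "antimono h"
    and bounded: "weighted_hankel_bounded h (\<lambda>t. t powr \<alpha>) T"
  obtains B where "0 \<le> B"
    and "\<And>t. 0 < t \<Longrightarrow> t < 2 * T \<Longrightarrow> h t \<le> ennreal (B * t powr (- (1 + 2 * \<alpha>)))"
proof -
  let ?L = "lebesgue_on {0<..<T}"
  let ?\<Gamma> = "weighted_hankel h (\<lambda>t. t powr \<alpha>) T"
  have [measurable]: "(\<lambda>x. x) \<in> borel_measurable ?L"
    using id_borel_measurable_lebesgue_on[of "{0<..<T}"] by (simp add: id_def)
  interpret finite_measure ?L by (rule finite_measure_lebesgue_on) simp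
  obtain C where C: "weighted_hankel_defined h (\<lambda>t. t powr \<alpha>) T u"
      "?\<Gamma> u \<in> L2_on T" "L2_on_norm T (?\<Gamma> u) \<le> C * L2_on_norm T u"
    if "u \<in> L2_on T" for u
    using bounded unfolding weighted_hankel_bounded_def by blast
  have "(\<lambda>_. 1) \<in> L2_on T" by (simp add: L2_on_def)
  then have fin: "h s < \<infinity>" if "0 < s" for s
    using finite_of_weighted_hankel_defined[OF \<open>0 < T\<close> h \<open>antimono h\<close> _ that] C(1) by blast
  have est: "(t / 4) powr (1 + 2 * \<alpha>) * enn2real (h t) \<le> \<bar>C\<bar>" if t: "0 < t" "t < 2 * T" for t
  proof -
    define a where "a = t / 4"
    have a: "0 < a" "2 * a < T" "t = 4 * a" using t by (auto simp: a_def)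
    define I where "I = {a<..<2 * a}"
    have I [measurable]: "I \<in> sets ?L" and I_em: "emeasure ?L I = ennreal a"
      using a by (simp_all add: I_def sets_lebesgue_on_interval emeasure_lebesgue_on_interval)
    have I_sub: "I \<inter> {0<..<T} = I" using a by (auto simp: I_def)
    have I_m: "measure ?L I = a" using a I_em by (simp add: measure_def)
    define u where "u = (\<lambda>\<tau>. indicator I \<tau> :: complex)"
    have norm_u: "(norm (u \<tau>))\<^sup>2 = indicator I \<tau>" for \<tau> by (simp add: u_def indicator_def)
    have u: "u \<in> L2_on T"
      unfolding L2_on_def mem_Collect_eq norm_u using I I_em
      by (auto simp: u_def intro!: integrable_real_indicator)
    have u_norm: "L2_on_norm T u = sqrt a"
      unfolding L2_on_norm_def norm_u using I I_m by (simp add: I_sub)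
    define q where "q = a powr (1 + 2 * \<alpha>) * enn2real (h t)"
    have q: "0 \<le> q" by (simp add: q_def)
    have "AE s in ?L. q * indicator I s \<le> norm (?\<Gamma> u s)"
      using C(1)[OF u] unfolding weighted_hankel_defined_def
    proof eventually_elim
      case (elim s)
      show ?case
      proof (cases "s \<in> I")
        case True
        then have s: "a < s" "s < 2 * a" by (auto simp: I_def)
        define r where "r = (\<lambda>\<tau>. s powr \<alpha> * enn2real (h (s + \<tau>)) * \<tau> powr \<alpha> * indicator I \<tau>)"
        have r_meas: "r \<in> borel_measurable ?L" unfolding r_def by measurable
        have r_nn: "0 \<le> r \<tau>" for \<tau> by (simp add: r_def)
        have "(\<integral>\<^sup>+\<tau>. ennreal (norm (r \<tau>)) \<partial>?L)
            \<le> (\<integral>\<^sup>+\<tau>. ennreal \<bar>s powr \<alpha>\<bar> * h (s + \<tau>) * ennreal \<bar>\<tau> powr \<alpha>\<bar> * ennreal (norm (u \<tau>)) \<partial>?L)"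
        proof (rule nn_integral_mono)
          fix \<tau> assume "\<tau> \<in> space ?L"
          then have "h (s + \<tau>) < \<infinity>" using s a by (intro fin) simp
          then show "ennreal (norm (r \<tau>)) \<le> ennreal \<bar>s powr \<alpha>\<bar> * h (s + \<tau>) * ennreal \<bar>\<tau> powr \<alpha>\<bar> * ennreal (norm (u \<tau>))"
            by (simp add: r_def u_def indicator_def ennreal_mult)
        qed
        with elim have r_int: "integrable ?L r"
          using r_meas by (intro integrableI_bounded) (auto dest: le_less_trans)
        have "?\<Gamma> u s = (LINT \<tau>|?L. complex_of_real (r \<tau>))"
          unfolding weighted_hankel_def
          by (intro Bochner_Integration.integral_cong) (auto simp: r_def u_def indicator_def)
        also have "\<dots> = of_real (LINT \<tau>|?L. r \<tau>)" by simp
        finally have \<Gamma>: "norm (?\<Gamma> u s) = (LINT \<tau>|?L. r \<tau>)"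
          using r_nn by (simp add: integral_nonneg_AE)
        have "a powr (1 + 2 * \<alpha>) = a powr (1 + \<alpha> + \<alpha>)" by (simp add: algebra_simps)
        also have "\<dots> = a powr \<alpha> * a powr \<alpha> * a" using a by (simp only: powr_add) simp
        finally have "q = (LINT \<tau>|?L. a powr \<alpha> * enn2real (h t) * a powr \<alpha> * indicator I \<tau>)"
          using I I_m by (simp add: q_def I_sub)
        also have "\<dots> \<le> (LINT \<tau>|?L. r \<tau>)"
        proof (rule integral_mono)
          show "integrable ?L (\<lambda>\<tau>. a powr \<alpha> * enn2real (h t) * a powr \<alpha> * indicator I \<tau>)"
            using I I_em by (intro integrable_mult_right integrable_real_indicator) auto
          fix \<tau>
          show "a powr \<alpha> * enn2real (h t) * a powr \<alpha> * indicator I \<tau> \<le> r \<tau>"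
          proof (cases "\<tau> \<in> I")
            case True
            then have \<tau>: "a < \<tau>" "\<tau> < 2 * a" by (auto simp: I_def)
            have "enn2real (h t) \<le> enn2real (h (s + \<tau>))"
              using s \<tau> a fin[of "s + \<tau>"] \<open>antimono h\<close>
              by (intro enn2real_mono) (auto intro: antimonoD)
            then have "a powr \<alpha> * enn2real (h t) * a powr \<alpha> \<le> s powr \<alpha> * enn2real (h (s + \<tau>)) * \<tau> powr \<alpha>"
              using s \<tau> a \<open>0 \<le> \<alpha>\<close> by (intro mult_mono powr_mono2) auto
            then show ?thesis using True by (simp add: r_def)
          qed (simp add: r_def)
        qed (fact r_int)
        finally show ?thesis using True \<Gamma> by simp
      qed simp
    qed
    then have "(\<integral>\<^sup>+s. ennreal (q\<^sup>2) * indicator I s \<partial>?L) \<le> (\<integral>\<^sup>+s. ennreal ((norm (?\<Gamma> u s))\<^sup>2) \<partial>?L)"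
    proof (intro nn_integral_mono_AE, eventually_elim)
      case (elim s)
      then show ?case using q by (auto simp: indicator_def intro!: ennreal_leI power_mono)
    qed
    also have "\<dots> = ennreal (LINT s|?L. (norm (?\<Gamma> u s))\<^sup>2)"
      using C(2)[OF u] by (intro nn_integral_eq_integral) (auto simp: L2_on_def)
    also have "\<dots> = ennreal ((L2_on_norm T (?\<Gamma> u))\<^sup>2)"
      unfolding L2_on_norm_def by (subst real_sqrt_pow2) (auto intro: integral_nonneg_AE)
    also have "\<dots> \<le> ennreal ((C * sqrt a)\<^sup>2)"
      using C(3)[OF u] unfolding u_norm
      by (intro ennreal_leI power_mono) (auto simp: L2_on_norm_def intro: integral_nonneg_AE)
    also have "(C * sqrt a)\<^sup>2 = \<bar>C\<bar>\<^sup>2 * a" using a by (simp add: power_mult_distrib)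
    finally have "q\<^sup>2 * a \<le> \<bar>C\<bar>\<^sup>2 * a"
      using a I I_em by (simp add: nn_integral_cmult_indicator ennreal_mult[symmetric])
    then have "q\<^sup>2 \<le> \<bar>C\<bar>\<^sup>2" using a by simp
    then have "q \<le> \<bar>C\<bar>" by (rule power2_le_imp_le) simp
    then show ?thesis by (simp add: q_def a_def)
  qed
  show thesis
  proof (rule that[of "\<bar>C\<bar> * 4 powr (1 + 2 * \<alpha>)"])
    fix t assume t: "0 < t" "t < 2 * T"
    let ?p = "1 + 2 * \<alpha>"
    have "(t / 4) powr q * (4 powr q * t powr (- q)) = 1" for q
      using t by (simp add: powr_divide powr_minus_divide)
    then have "enn2real (h t) = ((t / 4) powr ?p * enn2real (h t)) * (4 powr ?p * t powr (- ?p))"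
      by (simp only: mult_ac mult_1_right)
    also have "\<dots> \<le> \<bar>C\<bar> * (4 powr ?p * t powr (- ?p))"
      using est[OF t] by (intro mult_right_mono) auto
    finally have "ennreal (enn2real (h t)) \<le> ennreal (\<bar>C\<bar> * 4 powr ?p * t powr (- ?p))"
      by (intro ennreal_leI) (simp add: mult_ac)
    then show "h t \<le> ennreal (\<bar>C\<bar> * 4 powr ?p * t powr (- ?p))"
      using fin[OF t(1)] by (simp only: ennreal_enn2real infinity_ennreal_def)
  qed simp
qed

section \<open>The boundedness criterion\<close>

theorem theorem4p3:
  fixes T \<alpha> :: real and M :: "real measure"
  assumes "0 < T" and "0 \<le> \<alpha>"
    and "sets M = sets borel" and "emeasure M {..0} = 0"
  shows "weighted_hankel_bounded (laplace_transform M) (\<lambda>t. t powr \<alpha>) T \<longleftrightarrow>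
         (\<exists>\<gamma>>0. \<forall>x\<ge>1. emeasure M {0<..<x} \<le> ennreal (\<gamma> * x powr (1 + 2 * \<alpha>)))"
proof
  let ?p = "1 + 2 * \<alpha>"
  assume "weighted_hankel_bounded (laplace_transform M) (\<lambda>t. t powr \<alpha>) T"
  then obtain B where B: "0 \<le> B"
    and decay: "\<And>t. 0 < t \<Longrightarrow> t < 2 * T \<Longrightarrow> laplace_transform M t \<le> ennreal (B * t powr (- ?p))"
    using decay_of_weighted_hankel_bounded[OF assms(1,2) borel_measurable_laplace_transform _]
      laplace_transform_antimono unfolding antimono_def by metis
  \<comment> \<open>The decay estimate is applied at \<open>t = c / x\<close>: \<open>c < 2 * T\<close> keeps this inside its range for every
    \<open>x \<ge> 1\<close>, and \<open>c \<le> 1\<close> makes \<open>exp (x * t)\<close> at most \<open>exp 1\<close>.\<close>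
  define c where "c = min 1 T"
  have c: "0 < c" "c \<le> 1" "c < 2 * T" using assms by (auto simp: c_def)
  define \<gamma> where "\<gamma> = exp 1 * B * c powr (- ?p)"
  \<comment> \<open>The constant must be positive, while \<open>\<gamma>\<close> vanishes when \<open>B = 0\<close>.\<close>
  have "emeasure M {0<..<x} \<le> ennreal ((\<gamma> + 1) * x powr ?p)" if x: "1 \<le> x" for x
  proof -
    define t where "t = c / x"
    have "c * 1 \<le> c * x" using x c by (intro mult_left_mono) auto
    then have "t \<le> c" using x by (simp add: t_def pos_divide_le_eq)
    then have t: "0 < t" "t < 2 * T" "x * t = c" using c x by (auto simp: t_def)
    have "ennreal 1 * emeasure M {0<..<x} \<le> ennreal (exp 1) * (ennreal (exp (- (x * t))) * emeasure M {0<..<x})"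
      unfolding mult.assoc[symmetric] ennreal_mult[symmetric, OF exp_ge_zero exp_ge_zero] using t c
      by (intro mult_right_mono ennreal_leI) (auto simp: mult_exp_exp)
    also have "\<dots> \<le> ennreal (exp 1) * ennreal (B * t powr (- ?p))"
      using laplace_transform_ge[OF assms(3), of t x] decay[OF t(1,2)] t
      by (intro mult_left_mono) auto
    also have "\<dots> = ennreal (exp 1 * (B * t powr (- ?p)))"
      using B by (intro ennreal_mult[symmetric]) auto
    also have "exp 1 * (B * t powr (- ?p)) = \<gamma> * x powr ?p"
    proof -
      have "(c / x) powr (- q) = c powr (- q) * x powr q" for q
        using c x by (simp add: powr_divide powr_minus_divide)
      then show ?thesis by (simp only: t_def \<gamma>_def mult.assoc)
    qed
    also have "ennreal \<dots> \<le> ennreal ((\<gamma> + 1) * x powr ?p)"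
      by (intro ennreal_leI mult_right_mono) auto
    finally show ?thesis by simp
  qed
  moreover have "0 < \<gamma> + 1" using B by (simp add: \<gamma>_def add_nonneg_pos)
  ultimately show "\<exists>\<gamma>>0. \<forall>x\<ge>1. emeasure M {0<..<x} \<le> ennreal (\<gamma> * x powr ?p)" by blast
next
  let ?p = "1 + 2 * \<alpha>"
  assume "\<exists>\<gamma>>0. \<forall>x\<ge>1. emeasure M {0<..<x} \<le> ennreal (\<gamma> * x powr ?p)"
  then obtain \<gamma> where \<gamma>: "0 < \<gamma>"
    and growth: "\<And>x. 1 \<le> x \<Longrightarrow> emeasure M {0<..<x} \<le> ennreal (\<gamma> * x powr ?p)" by blast
  \<comment> \<open>Reaching all \<open>t < 2 * T\<close> requires the growth condition from \<open>x = 1 / (2 * T)\<close> on, possibly below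
    \<open>1\<close>. Enlarging \<open>x\<close> to \<open>D * x \<ge> 1\<close> costs only the constant factor \<open>D powr (1 + 2 * \<alpha>)\<close>.\<close>
  define D where "D = max 1 (2 * T)"
  have D: "1 \<le> D" "2 * T \<le> D" by (auto simp: D_def)
  have "emeasure M {0<..<x} \<le> ennreal (\<gamma> * D powr ?p * x powr ?p)" if x: "1 / (2 * T) \<le> x" for x
  proof -
    have x_pos: "0 < x" using x assms(1) by (smt (verit) divide_pos_pos)
    have "1 \<le> 2 * T * x" using x assms(1) by (simp add: pos_divide_le_eq mult.commute)
    also have "\<dots> \<le> D * x" using D x_pos by (intro mult_right_mono) auto
    finally have Dx: "1 \<le> D * x" .
    have "x \<le> D * x" using D x_pos by simp
    then have "{0<..<x} \<subseteq> {0<..<D * x}"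
      by (metis greaterThanLessThan_subseteq_greaterThanLessThan order_refl)
    then have "emeasure M {0<..<x} \<le> emeasure M {0<..<D * x}"
      using assms(3) by (intro emeasure_mono) auto
    also have "\<dots> \<le> ennreal (\<gamma> * (D * x) powr ?p)" using Dx by (rule growth)
    also have "\<gamma> * (D * x) powr ?p = \<gamma> * D powr ?p * x powr ?p"
      using D x_pos by (simp add: powr_mult)
    finally show ?thesis .
  qed
  then obtain B where B: "0 \<le> B"
    and decay: "\<And>t. 0 < t \<Longrightarrow> t * (1 / (2 * T)) \<le> 1 \<Longrightarrow> laplace_transform M t \<le> ennreal (B * t powr (- ?p))"
    using laplace_transform_le_of_growth[OF assms(3), where b = "1 / (2 * T)" and \<gamma> = "\<gamma> * D powr ?p" and p = ?p] \<gamma> assms(1)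
    by auto
  show "weighted_hankel_bounded (laplace_transform M) (\<lambda>t. t powr \<alpha>) T"
    using assms(1,2) B borel_measurable_laplace_transform
  proof (rule weighted_hankel_bounded_of_decay)
    fix t assume "0 < t" "t < 2 * T"
    then show "laplace_transform M t \<le> ennreal (B * t powr (- ?p))"
      by (intro decay) (auto simp: pos_divide_le_eq)
  qed
qed

end
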